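(* Let $w_1,w_2,w_3$ be any odd positive integers, let $y_1\in\mathbb{Z}_p$, and let $n\ge 0$ be an integer. Then the following six expressions are all equal: \begin{align*} &w_1^n\sum_{k=0}^{n}\binom{n}{k}\sum_{a=0}^{w_1d-1}(-1)^a\chi(a)\xi^{aw_2w_3}E_{k,\chi,\xi^{w_1w_3}}\Big(w_2y_1+\frac{w_2}{w_1}a\Big)T_{n-k}(w_3d-1;\chi,\xi^{w_1w_2})w_2^{n-k}w_3^k\\ =&w_1^n\sum_{k=0}^{n}\binom{n}{k}\sum_{a=0}^{w_1d-1}(-1)^a\chi(a)\xi^{aw_2w_3}E_{k,\chi,\xi^{w_1w_2}}\Big(w_3y_1+\frac{w_3}{w_1}a\Big)T_{n-k}(w_2d-1;\chi,\xi^{w_1w_3})w_3^{n-k}w_2^k\\ =&w_2^n\sum_{k=0}^{n}\binom{n}{k}\sum_{a=0}^{w_2d-1}(-1)^a\chi(a)\xi^{aw_1w_3}E_{k,\chi,\xi^{w_2w_3}}\Big(w_1y_1+\frac{w_1}{w_2}a\Big)T_{n-k}(w_3d-1;\chi,\xi^{w_1w_2})w_1^{n-k}w_3^k\\ =&w_2^n\sum_{k=0}^{n}\binom{n}{k}\sum_{a=0}^{w_2d-1}(-1)^a\chi(a)\xi^{aw_1w_3}E_{k,\chi,\xi^{w_1w_2}}\Big(w_3y_1+\frac{w_3}{w_2}a\Big)T_{n-k}(w_1d-1;\chi,\xi^{w_2w_3})w_3^{n-k}w_1^k\\ =&w_3^n\sum_{k=0}^{n}\binom{n}{k}\sum_{a=0}^{w_3d-1}(-1)^a\chi(a)\xi^{aw_1w_2}E_{k,\chi,\xi^{w_2w_3}}\Big(w_1y_1+\frac{w_1}{w_3}a\Big)T_{n-k}(w_2d-1;\chi,\xi^{w_1w_3})w_1^{n-k}w_2^k\\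 =&w_3^n\sum_{k=0}^{n}\binom{n}{k}\sum_{a=0}^{w_3d-1}(-1)^a\chi(a)\xi^{aw_1w_2}E_{k,\chi,\xi^{w_1w_3}}\Big(w_2y_1+\frac{w_2}{w_3}a\Big)T_{n-k}(w_1d-1;\chi,\xi^{w_2w_3})w_2^{n-k}w_1^k. \end{align*}
   Context: Let $p$ be a fixed odd prime, $\mathbb{Z}_p$ the $p$-adic integers, $\mathbb{C}_p$ the completion of an algebraic closure of $\mathbb{Q}_p$. Let $\xi\in\mathbb{C}_p$ be a fixed ramified root of unity, i.e. $\xi^{p^s}=1$ for some positive integer $s$. Let $d$ be a fixed odd positive integer and $\chi$ a primitive Dirichlet character of conductor $d$, regarded as a function on the integers (periodic mod $d$, zero on integers not coprime to $d$) with values in $\mathbb{C}_p$ via a fixed embedding $\overline{\mathbb{Q}}\to\mathbb{C}_p$. For a ramified root of unity $\zeta$ (e.g. $\zeta=\xi^{w}$), the generalized twisted Euler polynomials $E_{n,\chi,\zeta}(x)$ are the polynomials in $x$ (evaluated at arbitrary $x\in\mathbb{C}_p$) defined by $$\frac{2e^{xt}}{\zeta^d e^{dt}+1}\sum_{a=0}^{d-1}(-1)^a\chi(a)\zeta^a e^{at}=\sum_{n=0}^{\infty}E_{n,\chi,\zeta}(x)\frac{t^n}{n!}.$$ The alternating generalized twisted power sum is $T_k(N;\chi,\zeta)=\sum_{a=0}^{N}(-1)^a\chi(a)\zeta^a a^k$ (with $0^0=1$). *)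

theory Defs
  imports "HOL-Analysis.Elementary_Metric_Spaces" "HOL-Computational_Algebra.Computational_Algebra"
begin

section \<open>The field of p-adic complex numbers\<close>

definition padic_abs :: "nat \<Rightarrow> rat \<Rightarrow> real" where
  "padic_abs p q =
     (if q = 0 then 0
      else real p powi (int (multiplicity (int p) (snd (quotient_of q)))
                        - int (multiplicity (int p) (fst (quotient_of q)))))"

text \<open>The libraries contain no p-adic numbers. A type carrying a complete metric is said to be a
  field of p-adic complex numbers if the metric comes from an absolute value extending the p-adic
  one on the rationals and the type is the completion of an algebraic closure of the p-adic
  numbers. By completeness, the topological closure of the rationals is their completion, and the
  two sets below are the p-adic numbers and p-adic integers inside the type. The conditions
  determine the field up to isometric isomorphism.\<close>

definition Qp :: "'a::{field_char_0, metric_space} set" where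
  "Qp = closure \<rat>"

definition Zp :: "'a::{field_char_0, metric_space} set" where
  "Zp = {x \<in> Qp. dist x 0 \<le> 1}"

definition Qp_bar :: "'a::{field_char_0, metric_space} set" where
  "Qp_bar = {x. \<exists>P. P \<noteq> 0 \<and> (\<forall>i. coeff P i \<in> Qp) \<and> poly P x = 0}"

definition is_Cp :: "nat \<Rightarrow> 'a::{field_char_0, complete_space} itself \<Rightarrow> bool" where
  "is_Cp p (_ :: 'a itself) \<longleftrightarrow>
     (\<forall>x y :: 'a. dist x y = dist (x - y) 0) \<and>
     (\<forall>x y :: 'a. dist (x * y) 0 = dist x 0 * dist y 0) \<and>
     (\<forall>x y :: 'a. dist (x + y) 0 \<le> max (dist x 0) (dist y 0)) \<and>
     (\<forall>q. dist (of_rat q :: 'a) 0 = padic_abs p q) \<and>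
     (\<forall>P :: 'a poly. degree P > 0 \<and> (\<forall>i. coeff P i \<in> Qp_bar) \<longrightarrow> (\<exists>x\<in>Qp_bar. poly P x = 0)) \<and>
     closure (Qp_bar :: 'a set) = UNIV"

text \<open>Embeddings into a field of the algebraic closure of the rationals, realised as the set of
  algebraic complex numbers. Values at transcendental arguments are irrelevant, and injectivity
  is automatic for a unital ring homomorphism between fields.\<close>

definition Qbar_embedding :: "(complex \<Rightarrow> 'a::field_char_0) \<Rightarrow> bool" where
  "Qbar_embedding \<iota> \<longleftrightarrow> \<iota> 1 = 1 \<and>
     (\<forall>x y. algebraic x \<longrightarrow> algebraic y \<longrightarrow> \<iota> (x + y) = \<iota> x + \<iota> y \<and> \<iota> (x * y) = \<iota> x * \<iota> y)"

definition ramified_root_of_unity :: "nat \<Rightarrow> 'a::field_char_0 \<Rightarrow> bool" where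
  "ramified_root_of_unity p \<xi> \<longleftrightarrow> (\<exists>s>0. \<xi> ^ (p ^ s) = 1)"


section \<open>Dirichlet characters\<close>

definition dirichlet_character :: "nat \<Rightarrow> (int \<Rightarrow> complex) \<Rightarrow> bool" where
  "dirichlet_character d chi \<longleftrightarrow> d > 0 \<and>
     (\<forall>a. chi (a + int d) = chi a) \<and>
     (\<forall>a b. chi (a * b) = chi a * chi b) \<and>
     (\<forall>a. chi a = 0 \<longleftrightarrow> \<not> coprime a (int d))"

text \<open>The least divisor \<open>m\<close> of the modulus \<open>d\<close> such that the character is
  induced by a character modulo \<open>m\<close>.\<close>

definition conductor :: "nat \<Rightarrow> (int \<Rightarrow> complex) \<Rightarrow> nat" where
  "conductor d chi = (LEAST m. m dvd d \<and>
     (\<exists>\<psi>. dirichlet_character m \<psi> \<and> (\<forall>a. coprime a (int d) \<longrightarrow> chi a = \<psi> a)))"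

definition primitive_character :: "nat \<Rightarrow> (int \<Rightarrow> complex) \<Rightarrow> bool" where
  "primitive_character d chi \<longleftrightarrow> dirichlet_character d chi \<and> conductor d chi = d"


section \<open>Twisted Euler polynomials and power sums\<close>

text \<open>The quotient of formal power series is the intended one when \<open>\<zeta> ^ d \<noteq> -1\<close>, which
  holds for odd \<open>d\<close> and \<open>\<zeta>\<close> a root of unity of odd order.\<close>

definition euler_gf :: "nat \<Rightarrow> (int \<Rightarrow> 'a::field_char_0) \<Rightarrow> 'a \<Rightarrow> 'a \<Rightarrow> 'a fps" where
  "euler_gf d chi \<zeta> x =
     2 * fps_exp x / (fps_const (\<zeta> ^ d) * fps_exp (of_nat d) + 1) *
     (\<Sum>a<d. fps_const ((-1) ^ a * chi (int a) * \<zeta> ^ a) * fps_exp (of_nat a))"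

definition euler_E :: "nat \<Rightarrow> nat \<Rightarrow> (int \<Rightarrow> 'a::field_char_0) \<Rightarrow> 'a \<Rightarrow> 'a \<Rightarrow> 'a" where
  "euler_E d n chi \<zeta> x = fact n * fps_nth (euler_gf d chi \<zeta> x) n"

definition power_sum_T :: "nat \<Rightarrow> nat \<Rightarrow> (int \<Rightarrow> 'a::field_char_0) \<Rightarrow> 'a \<Rightarrow> 'a" where
  "power_sum_T k N chi \<zeta> = (\<Sum>a=0..N. (-1) ^ a * chi (int a) * \<zeta> ^ a * of_nat a ^ k)"

lemma euler_E_polynomial:
  assumes "\<zeta> ^ d \<noteq> -1"
  shows "\<exists>P. \<forall>x. euler_E d n chi \<zeta> x = poly P x"
proof -
  define D where "D = fps_const (\<zeta> ^ d) * fps_exp (of_nat d) + 1"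
  define S where "S = (\<Sum>a<d. fps_const ((-1) ^ a * chi (int a) * \<zeta> ^ a) * fps_exp (of_nat a))"
  define G where "G = 2 * inverse D * S"
  have "fps_nth D 0 \<noteq> 0"
    using assms by (simp add: D_def add_eq_0_iff2)
  then have gf: "euler_gf d chi \<zeta> x = fps_exp x * G" for x
    by (simp add: euler_gf_def fps_divide_unit D_def S_def G_def mult_ac)
  have "euler_E d n chi \<zeta> x =
      poly (\<Sum>i=0..n. monom (fact n * fps_nth G (n - i) / fact i) i) x" for x
    unfolding euler_E_def gf fps_mult_nth poly_sum poly_monom sum_distrib_left
    by (rule sum.cong) simp_all
  then show ?thesis by blast
qed

end

theory Submission imports Defs
begin

text \<open>With \<open>Q = \<xi> e\<^sup>t\<close> and \<open>S\<^sub>N(q) = \<Sum>a<N. \<chi>(a) (-q)\<^sup>a\<close>, the first expression divided by \<open>n!\<close> is the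
  coefficient of \<open>t\<^sup>n\<close> in
  \<open>2 exp (w\<^sub>1 w\<^sub>2 w\<^sub>3 y\<^sub>1 t) S\<^bsub>w\<^sub>1d\<^esub>(q\<^sub>1) S\<^bsub>d\<^esub>(q\<^sub>2) S\<^bsub>w\<^sub>3d\<^esub>(q\<^sub>3) / (1 + q\<^sub>2\<^sup>d)\<close>, where
  \<open>q\<^sub>i\<close> is the power of \<open>Q\<close> with exponent \<open>w\<^sub>1 w\<^sub>2 w\<^sub>3 / w\<^sub>i\<close>.
  For odd \<open>w\<close> and \<open>d\<close>, periodicity of \<open>\<chi>\<close> gives
  \<open>S\<^bsub>wd\<^esub>(q) (1 + q\<^sup>d) = S\<^bsub>d\<^esub>(q) (1 + q\<^bsup>wd\<^esup>)\<close>. Multiplying by the three factors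
  \<open>1 + q\<^sub>i\<^sup>d\<close> therefore turns the series into an expression symmetric in the \<open>w\<^sub>i\<close>.\<close>

lemma sum_periodic_times_geometric:
  fixes f :: "nat \<Rightarrow> 'a::comm_ring_1"
  assumes "\<And>a. f (a + d) = f a"
  shows "(\<Sum>a<w * d. f a * x ^ a) * (1 - x ^ d) = (\<Sum>a<d. f a * x ^ a) * (1 - x ^ (w * d))"
proof (induction w)
  case (Suc w)
  have per: "f (w * d + a) = f a" for a
  proof (induction w)
    case (Suc w)
    then show ?case
      using assms[of "w * d + a"] by (simp add: ac_simps)
  qed simp
  have "(\<Sum>a<Suc w * d. f a * x ^ a)
      = (\<Sum>a<w * d. f a * x ^ a) + (\<Sum>a=w*d..<w*d+d. f a * x ^ a)"
    by (simp only: sum.nat_group[symmetric] sum.lessThan_Suc)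
  also have "(\<Sum>a=w*d..<w*d+d. f a * x ^ a) = (\<Sum>a<d. f (w * d + a) * x ^ (w * d + a))"
    using sum.shift_bounds_nat_ivl[of "\<lambda>a. f a * x ^ a" 0 "w * d" d]
    by (simp add: add.commute atLeast0LessThan)
  also have "\<dots> = x ^ (w * d) * (\<Sum>a<d. f a * x ^ a)"
    unfolding per power_add sum_distrib_left by (simp add: mult_ac)
  finally have "(\<Sum>a<Suc w * d. f a * x ^ a) * (1 - x ^ d)
      = (\<Sum>a<w * d. f a * x ^ a) * (1 - x ^ d) + x ^ (w * d) * (\<Sum>a<d. f a * x ^ a) * (1 - x ^ d)"
    by (simp add: distrib_right)
  then show ?case
    unfolding Suc.IH mult_Suc power_add by (simp add: ring_distribs mult_ac)
qed simp

definition char_sum :: "(int \<Rightarrow> 'a::field_char_0) \<Rightarrow> nat \<Rightarrow> 'a fps \<Rightarrow> 'a fps" where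
  "char_sum chi N q = (\<Sum>a<N. fps_const (chi (int a)) * (- q) ^ a)"

lemma char_sum_mult:
  assumes "\<And>a. chi (a + int d) = chi a" "odd d" "odd w"
  shows "char_sum chi (w * d) q * (q ^ d + 1) = char_sum chi d q * (q ^ (w * d) + 1)"
  using sum_periodic_times_geometric[where f = "\<lambda>a. fps_const (chi (int a))" and x = "- q"
      and d = d and w = w] assms
  by (simp add: char_sum_def add.commute)

definition twist :: "'a::field_char_0 \<Rightarrow> 'a fps" where
  "twist \<xi> = fps_const \<xi> * fps_exp 1"

lemma twist_power: "twist \<xi> ^ m = fps_const (\<xi> ^ m) * fps_exp (of_nat m)"
  by (simp add: twist_def power_mult_distrib fps_exp_power_mult)

lemma char_sum_twist:
  "char_sum chi N (twist \<xi> ^ m) =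
     (\<Sum>a<N. fps_const ((-1) ^ a * chi (int a) * \<xi> ^ (m * a)) * fps_exp (of_nat (m * a)))"
proof -
  have "(- (twist \<xi> ^ m)) ^ a = fps_const ((-1) ^ a) * twist \<xi> ^ (m * a)" for a
    by (simp add: power_minus[of "twist \<xi> ^ m"] power_mult flip: fps_const_neg fps_const_power)
  then show ?thesis
    by (simp add: char_sum_def twist_power flip: fps_const_mult mult.assoc) (simp add: mult_ac)
qed

lemma fps_nth_compose_scale: "(f oo (fps_const c * fps_X)) $ k = c ^ k * f $ k"
  for f :: "'a::field_char_0 fps"
  by (simp add: fps_compose_linear)

lemma euler_gf_scaled:
  assumes "\<xi> ^ (m * d) \<noteq> -1"
  shows "(euler_gf d chi (\<xi> ^ m) x oo (fps_const (of_nat m) * fps_X)) * (twist \<xi> ^ (m * d) + 1)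
       = 2 * fps_exp (of_nat m * x) * char_sum chi d (twist \<xi> ^ m)"
proof -
  let ?s = "\<lambda>f. f oo (fps_const (of_nat m) * fps_X :: 'a fps)"
  let ?D = "fps_const ((\<xi> ^ m) ^ d) * fps_exp (of_nat d) + 1 :: 'a fps"
  let ?S = "\<Sum>a<d. fps_const ((-1) ^ a * chi (int a) * (\<xi> ^ m) ^ a) * fps_exp (of_nat a)"
  have scale_exp: "?s (fps_exp b) = fps_exp (of_nat m * b)" for b
    by (simp add: fps_eq_iff fps_nth_compose_scale power_mult_distrib)
  have mult: "?s (f * g) = ?s f * ?s g" for f g
    by (simp add: fps_compose_mult_distrib)
  have "is_unit ?D"
    using assms by (simp add: add_eq_0_iff2 power_mult)
  then have "2 * fps_exp x / ?D * ?D = 2 * fps_exp x"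
    by (rule dvd_div_mult_self[OF unit_imp_dvd])
  then have "euler_gf d chi (\<xi> ^ m) x * ?D = 2 * fps_exp x * ?S"
    unfolding euler_gf_def mult.commute[of _ ?S] mult.assoc[of ?S]
    by (rule arg_cong[where f = "\<lambda>f. ?S * f"])
  then have "?s (euler_gf d chi (\<xi> ^ m) x) * ?s ?D = ?s 2 * ?s (fps_exp x) * ?s ?S"
    by (simp only: flip: mult)
  moreover have "?s ?D = twist \<xi> ^ (m * d) + 1"
    by (simp add: fps_compose_add_distrib fps_compose_mult_distrib scale_exp twist_power
        flip: power_mult)
  moreover have "?s ?S = char_sum chi d (twist \<xi> ^ m)"
    by (simp add: fps_compose_sum_distrib fps_compose_mult_distrib scale_exp char_sum_twist
        power_mult)
  moreover have "?s 2 = 2"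
    by simp
  ultimately show ?thesis
    by (simp add: scale_exp)
qed

lemma power_sum_T_eq_coeff:
  assumes "N > 0"
  shows "of_nat m ^ k * power_sum_T k (N - 1) chi (\<xi> ^ m)
       = fact k * char_sum chi N (twist \<xi> ^ m) $ k"
proof -
  have "{0..N - 1} = {..<N}"
    using assms by auto
  then show ?thesis
    by (simp add: power_sum_T_def char_sum_twist fps_sum_nth sum_distrib_left power_mult_distrib
        mult_ac flip: power_mult)
qed

definition mixed_sum ::
  "nat \<Rightarrow> (int \<Rightarrow> 'a::field_char_0) \<Rightarrow> 'a \<Rightarrow> 'a \<Rightarrow> nat \<Rightarrow> nat \<Rightarrow> nat \<Rightarrow> nat \<Rightarrow> 'a" where
  "mixed_sum d chi \<xi> y n u v w = of_nat u ^ n * (\<Sum>k=0..n. of_nat (n choose k) *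
     (\<Sum>a=0..u * d - 1. (-1) ^ a * chi (int a) * \<xi> ^ (a * v * w) *
        euler_E d k chi (\<xi> ^ (u * w)) (of_nat v * y + of_nat v / of_nat u * of_nat a)) *
     power_sum_T (n - k) (w * d - 1) chi (\<xi> ^ (u * v)) *
     of_nat v ^ (n - k) * of_nat w ^ k)"

definition mixed_gf ::
  "nat \<Rightarrow> (int \<Rightarrow> 'a::field_char_0) \<Rightarrow> 'a \<Rightarrow> 'a \<Rightarrow> nat \<Rightarrow> nat \<Rightarrow> nat \<Rightarrow> 'a fps" where
  "mixed_gf d chi \<xi> y u v w =
     (\<Sum>a<u * d. fps_const ((-1) ^ a * chi (int a) * \<xi> ^ (a * v * w)) *
        (euler_gf d chi (\<xi> ^ (u * w)) (of_nat v * y + of_nat v / of_nat u * of_nat a)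
          oo (fps_const (of_nat (u * w)) * fps_X))) *
     char_sum chi (w * d) (twist \<xi> ^ (u * v))"

lemma mixed_sum_eq_coeff:
  assumes "d > 0" "u > 0" "w > 0"
  shows "mixed_sum d chi \<xi> y n u v w = fact n * mixed_gf d chi \<xi> y u v w $ n"
proof -
  define c where "c a = (-1) ^ a * chi (int a) * \<xi> ^ (a * v * w)" for a
  define x where "x a = of_nat v * y + of_nat v / of_nat u * of_nat a" for a
  define G where "G a = euler_gf d chi (\<xi> ^ (u * w)) (x a)" for a
  define S where "S = char_sum chi (w * d) (twist \<xi> ^ (u * v))"
  have T: "of_nat (u * v) ^ k * power_sum_T k (w * d - 1) chi (\<xi> ^ (u * v)) = fact k * S $ k"
    for k
    unfolding S_def by (rule power_sum_T_eq_coeff) (use assms in simp)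
  have range: "{0..u * d - 1} = {..<u * d}"
    using assms by (auto simp: Suc_leI le_eq_less_or_eq)
  have "of_nat u ^ n * (of_nat (n choose k) *
      (\<Sum>a<u * d. c a * (fact k * G a $ k)) *
      power_sum_T (n - k) (w * d - 1) chi (\<xi> ^ (u * v)) * of_nat v ^ (n - k) * of_nat w ^ k)
    = fact n * ((\<Sum>a<u * d. c a * (of_nat (u * w) ^ k * G a $ k)) * S $ (n - k))"
    (is "?l = ?r") if "k \<le> n" for k
  proof -
    have "(of_nat u ^ n :: 'a) = of_nat u ^ k * of_nat u ^ (n - k)"
      using that by (simp flip: power_add)
    then have "?l = of_nat (n choose k) * fact k *
        (\<Sum>a<u * d. c a * (of_nat (u * w) ^ k * G a $ k)) *
        (of_nat (u * v) ^ (n - k) * power_sum_T (n - k) (w * d - 1) chi (\<xi> ^ (u * v)))"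
      by (simp add: power_mult_distrib mult_ac sum_distrib_left)
    also have "\<dots> = (of_nat (n choose k) * fact k * fact (n - k)) *
        ((\<Sum>a<u * d. c a * (of_nat (u * w) ^ k * G a $ k)) * S $ (n - k))"
      unfolding T by (simp only: mult_ac)
    also have "of_nat (n choose k) * fact k * fact (n - k) = (fact n :: 'a)"
      using that by (simp add: binomial_fact)
    finally show ?thesis .
  qed
  then have "mixed_sum d chi \<xi> y n u v w
      = (\<Sum>k=0..n. fact n * ((\<Sum>a<u * d. c a * (of_nat (u * w) ^ k * G a $ k)) * S $ (n - k)))"
    unfolding mixed_sum_def euler_E_def range c_def x_def G_def sum_distrib_left[of "of_nat u ^ n"]
    by (intro sum.cong refl) simp_all
  also have "\<dots> = fact n * mixed_gf d chi \<xi> y u v w $ n"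
    unfolding mixed_gf_def fps_mult_nth[of _ "char_sum _ _ _"] fps_sum_nth
      fps_mult_left_const_nth fps_nth_compose_scale c_def x_def G_def S_def sum_distrib_left[of "fact n"] ..
  finally show ?thesis .
qed

lemma mixed_gf_symmetric:
  fixes chi :: "int \<Rightarrow> 'a::field_char_0"
  assumes chi: "\<And>a. chi (a + int d) = chi a" "odd d"
    and odd: "odd u" "odd w"
    and unit: "\<xi> ^ (u * w * d) \<noteq> -1"
  shows "mixed_gf d chi \<xi> y u v w *
      ((twist \<xi> ^ (v * w * d) + 1) * (twist \<xi> ^ (u * w * d) + 1) * (twist \<xi> ^ (u * v * d) + 1))
    = 2 * fps_exp (of_nat (u * v * w) * y) * (twist \<xi> ^ (u * v * w * d) + 1)\<^sup>2 *
      (char_sum chi d (twist \<xi> ^ (v * w)) * char_sum chi d (twist \<xi> ^ (u * w)) *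
       char_sum chi d (twist \<xi> ^ (u * v)))"
proof -
  define c where "c a = (-1) ^ a * chi (int a) * \<xi> ^ (a * v * w)" for a
  define G where "G a = euler_gf d chi (\<xi> ^ (u * w)) (of_nat v * y + of_nat v / of_nat u * of_nat a)
          oo (fps_const (of_nat (u * w)) * fps_X)" for a
  define D where "D m = twist \<xi> ^ (m * d) + 1" for m
  define S where "S m = char_sum chi d (twist \<xi> ^ m)" for m
  define U where "U = twist \<xi> ^ (u * v * w * d) + 1"
  define ey where "ey = fps_exp (of_nat (u * v * w) * y)"
  have u: "u > 0"
    using odd by (auto intro: Nat.gr0I)
  have "G a * D (u * w) = 2 * ey * fps_exp (of_nat (v * w * a)) * S (u * w)" for a
  proof -
    have "of_nat (u * w) * (of_nat v * y + of_nat v / of_nat u * of_nat a)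
        = of_nat (u * v * w) * y + (of_nat (v * w * a) :: 'a)"
      using u by (simp add: field_simps)
    then show ?thesis
      unfolding G_def D_def S_def ey_def
      using euler_gf_scaled[OF unit, of chi] by (simp add: fps_exp_add_mult mult_ac)
  qed
  then have "(\<Sum>a<u * d. fps_const (c a) * G a) * D (u * w)
      = (\<Sum>a<u * d. fps_const (c a) * (2 * ey * fps_exp (of_nat (v * w * a)) * S (u * w)))"
    by (simp add: sum_distrib_right mult.assoc)
  also have "\<dots> = 2 * ey * char_sum chi (u * d) (twist \<xi> ^ (v * w)) * S (u * w)"
    by (simp add: char_sum_twist c_def sum_distrib_left sum_distrib_right mult_ac)
  finally have "mixed_gf d chi \<xi> y u v w * (D (v * w) * D (u * w) * D (u * v))
      = 2 * ey * (char_sum chi (u * d) (twist \<xi> ^ (v * w)) * D (v * w)) * S (u * w) *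
        (char_sum chi (w * d) (twist \<xi> ^ (u * v)) * D (u * v))"
    unfolding mixed_gf_def c_def[symmetric] G_def[symmetric] by (simp add: algebra_simps)
  also have "char_sum chi (u * d) (twist \<xi> ^ (v * w)) * D (v * w) = S (v * w) * U"
    using char_sum_mult[where chi = chi, OF chi odd(1), of "twist \<xi> ^ (v * w)"]
    by (simp add: D_def S_def U_def mult_ac flip: power_mult)
  also have "char_sum chi (w * d) (twist \<xi> ^ (u * v)) * D (u * v) = S (u * v) * U"
    using char_sum_mult[where chi = chi, OF chi odd(2), of "twist \<xi> ^ (u * v)"]
    by (simp add: D_def S_def U_def mult_ac flip: power_mult)
  finally show ?thesis
    by (simp add: D_def S_def U_def ey_def power2_eq_square mult_ac)
qed

lemma root_of_unity_power_neq_minus_one: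
  fixes \<xi> :: "'a::field_char_0"
  assumes "\<xi> ^ r = 1" "odd r"
  shows "\<xi> ^ m \<noteq> -1"
proof
  assume "\<xi> ^ m = -1"
  then have "(\<xi> ^ r) ^ m = -1"
    using assms(2) by (simp add: power_mult mult.commute[of r] flip: power_mult[of \<xi> r])
  then show False
    using assms(1) by simp
qed

lemma mixed_sum_permute:
  fixes chi :: "int \<Rightarrow> 'a::field_char_0"
  assumes chi: "\<And>a. chi (a + int d) = chi a" "odd d"
    and \<xi>: "\<xi> ^ r = 1" "odd r"
    and odd: "odd u" "odd v" "odd w"
  shows "mixed_sum d chi \<xi> y n u v w = mixed_sum d chi \<xi> y n u w v"
    and "mixed_sum d chi \<xi> y n u v w = mixed_sum d chi \<xi> y n v u w"
proof -
  have pos: "d > 0" "u > 0" "v > 0" "w > 0"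
    using chi odd by (auto intro: Nat.gr0I)
  note neq = root_of_unity_power_neq_minus_one[OF \<xi>]
  have nz: "twist \<xi> ^ m + 1 \<noteq> 0" for m
  proof
    assume "twist \<xi> ^ m + 1 = 0"
    then have "(twist \<xi> ^ m + 1) $ 0 = 0"
      by (simp only: fps_zero_nth)
    then show False
      using neq[of m] by (simp add: twist_power add_eq_0_iff2)
  qed
  let ?D = "(twist \<xi> ^ (v * w * d) + 1) * (twist \<xi> ^ (u * w * d) + 1) *
    (twist \<xi> ^ (u * v * d) + 1)"
  have D: "?D \<noteq> 0"
    using nz by simp
  note sym = mixed_gf_symmetric[where chi = chi and d = d and y = y and \<xi> = \<xi>, OF chi _ _ neq]
  have "mixed_gf d chi \<xi> y u v w * ?D = mixed_gf d chi \<xi> y u w v * ?D"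
    using sym[of u w v] sym[of u v w] odd by (simp add: mult_ac)
  then show "mixed_sum d chi \<xi> y n u v w = mixed_sum d chi \<xi> y n u w v"
    using D pos by (simp add: mixed_sum_eq_coeff)
  have "mixed_gf d chi \<xi> y u v w * ?D = mixed_gf d chi \<xi> y v u w * ?D"
    using sym[of u w v] sym[of v w u] odd by (simp add: mult_ac)
  then show "mixed_sum d chi \<xi> y n u v w = mixed_sum d chi \<xi> y n v u w"
    using D pos by (simp add: mixed_sum_eq_coeff)
qed

theorem theorem5:
  fixes p d w1 w2 w3 n :: nat
    and chi0 :: "int \<Rightarrow> complex"
    and \<iota> :: "complex \<Rightarrow> 'a::{field_char_0, complete_space}"
    and chi :: "int \<Rightarrow> 'a"
    and \<xi> y1 :: 'a
  assumes "prime p" and "odd p"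
    and "is_Cp p TYPE('a)"
    and "ramified_root_of_unity p \<xi>"
    and "d > 0" and "odd d"
    and "primitive_character d chi0"
    and "Qbar_embedding \<iota>"
    and "chi = (\<lambda>a. \<iota> (chi0 a))"
    and "w1 > 0" and "odd w1"
    and "w2 > 0" and "odd w2"
    and "w3 > 0" and "odd w3"
    and "y1 \<in> Zp"
  shows "let e1 = of_nat w1 ^ n * (\<Sum>k=0..n. of_nat (n choose k) *
              (\<Sum>a=0..w1 * d - 1. (-1) ^ a * chi (int a) * \<xi> ^ (a * w2 * w3) *
                 euler_E d k chi (\<xi> ^ (w1 * w3)) (of_nat w2 * y1 + of_nat w2 / of_nat w1 * of_nat a)) *
              power_sum_T (n - k) (w3 * d - 1) chi (\<xi> ^ (w1 * w2)) *
              of_nat w2 ^ (n - k) * of_nat w3 ^ k);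
         e2 = of_nat w1 ^ n * (\<Sum>k=0..n. of_nat (n choose k) *
              (\<Sum>a=0..w1 * d - 1. (-1) ^ a * chi (int a) * \<xi> ^ (a * w2 * w3) *
                 euler_E d k chi (\<xi> ^ (w1 * w2)) (of_nat w3 * y1 + of_nat w3 / of_nat w1 * of_nat a)) *
              power_sum_T (n - k) (w2 * d - 1) chi (\<xi> ^ (w1 * w3)) *
              of_nat w3 ^ (n - k) * of_nat w2 ^ k);
         e3 = of_nat w2 ^ n * (\<Sum>k=0..n. of_nat (n choose k) *
              (\<Sum>a=0..w2 * d - 1. (-1) ^ a * chi (int a) * \<xi> ^ (a * w1 * w3) *
                 euler_E d k chi (\<xi> ^ (w2 * w3)) (of_nat w1 * y1 + of_nat w1 / of_nat w2 * of_nat a)) *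
              power_sum_T (n - k) (w3 * d - 1) chi (\<xi> ^ (w1 * w2)) *
              of_nat w1 ^ (n - k) * of_nat w3 ^ k);
         e4 = of_nat w2 ^ n * (\<Sum>k=0..n. of_nat (n choose k) *
              (\<Sum>a=0..w2 * d - 1. (-1) ^ a * chi (int a) * \<xi> ^ (a * w1 * w3) *
                 euler_E d k chi (\<xi> ^ (w1 * w2)) (of_nat w3 * y1 + of_nat w3 / of_nat w2 * of_nat a)) *
              power_sum_T (n - k) (w1 * d - 1) chi (\<xi> ^ (w2 * w3)) *
              of_nat w3 ^ (n - k) * of_nat w1 ^ k);
         e5 = of_nat w3 ^ n * (\<Sum>k=0..n. of_nat (n choose k) *
              (\<Sum>a=0..w3 * d - 1. (-1) ^ a * chi (int a) * \<xi> ^ (a * w1 * w2) *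
                 euler_E d k chi (\<xi> ^ (w2 * w3)) (of_nat w1 * y1 + of_nat w1 / of_nat w3 * of_nat a)) *
              power_sum_T (n - k) (w2 * d - 1) chi (\<xi> ^ (w1 * w3)) *
              of_nat w1 ^ (n - k) * of_nat w2 ^ k);
         e6 = of_nat w3 ^ n * (\<Sum>k=0..n. of_nat (n choose k) *
              (\<Sum>a=0..w3 * d - 1. (-1) ^ a * chi (int a) * \<xi> ^ (a * w1 * w2) *
                 euler_E d k chi (\<xi> ^ (w1 * w3)) (of_nat w2 * y1 + of_nat w2 / of_nat w3 * of_nat a)) *
              power_sum_T (n - k) (w1 * d - 1) chi (\<xi> ^ (w2 * w3)) *
              of_nat w2 ^ (n - k) * of_nat w1 ^ k)
     in e1 = e2 \<and> e2 = e3 \<and> e3 = e4 \<and> e4 = e5 \<and> e5 = e6"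
proof -
  obtain s where s: "\<xi> ^ (p ^ s) = 1"
    using \<open>ramified_root_of_unity p \<xi>\<close> by (auto simp: ramified_root_of_unity_def)
  have "odd (p ^ s)"
    using \<open>odd p\<close> by simp
  have per: "chi (a + int d) = chi a" for a
    using assms by (simp add: primitive_character_def dirichlet_character_def)
  note perm = mixed_sum_permute[of chi, OF per \<open>odd d\<close> s \<open>odd (p ^ s)\<close>, of _ _ _ y1 n]
  let ?F = "mixed_sum d chi \<xi> y1 n"
  have "?F w1 w2 w3 = ?F w1 w3 w2" "?F w1 w3 w2 = ?F w2 w1 w3" "?F w2 w1 w3 = ?F w2 w3 w1"
    "?F w2 w3 w1 = ?F w3 w1 w2" "?F w3 w1 w2 = ?F w3 w2 w1"
    using perm assms(11,13,15) by metis+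
  then show ?thesis
    unfolding mixed_sum_def Let_def by (simp only: mult_ac simp_thms)
qed

end
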